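(* A matrix in $\mathcal{Q}(2)\otimes\mathcal{S}(2)$ is positive semidefinite if and only if its transpose is positive semidefinite.
   Context: $\mathcal{S}(2)$ is the real vector space of real symmetric $2\times2$ matrices. $\mathcal{Q}(N)$ is the real vector space of quaternionic hermitian $N\times N$ matrices ($A=A^*$, with $*$ the quaternionic conjugate transpose). A matrix $A\in\mathcal{Q}(N)$ is positive semidefinite if $v^*Av\ge0$ for all $v\in\mathbb{H}^N$. The (real) tensor product $\mathcal{Q}(2)\otimes\mathcal{S}(2)$ is regarded as a subspace of $\mathcal{Q}(4)$ via the Kronecker product; it consists of the quaternionic hermitian $4\times4$ matrices whose four $2\times2$ blocks are symmetric. The transpose is without conjugation. *)

theory Defs
  imports "HOL-Analysis.Analysis"
begin

section \<open>Quaternions\<close>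

datatype quat = Quat (qRe: real) (qI: real) (qJ: real) (qK: real)

lemma quat_eq_iff:
  "x = y \<longleftrightarrow> qRe x = qRe y \<and> qI x = qI y \<and> qJ x = qJ y \<and> qK x = qK y"
  by (cases x; cases y) simp

instantiation quat :: real_algebra_1
begin

definition "0 = Quat 0 0 0 0"
definition "1 = Quat 1 0 0 0"
definition "x + y = Quat (qRe x + qRe y) (qI x + qI y) (qJ x + qJ y) (qK x + qK y)"
definition "- x = Quat (- qRe x) (- qI x) (- qJ x) (- qK x)"
definition "x - y = Quat (qRe x - qRe y) (qI x - qI y) (qJ x - qJ y) (qK x - qK y)"
definition "x * y = Quat
   (qRe x * qRe y - qI x * qI y - qJ x * qJ y - qK x * qK y)
   (qRe x * qI y + qI x * qRe y + qJ x * qK y - qK x * qJ y)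
   (qRe x * qJ y - qI x * qK y + qJ x * qRe y + qK x * qI y)
   (qRe x * qK y + qI x * qJ y - qJ x * qI y + qK x * qRe y)"
definition "r *\<^sub>R x = Quat (r * qRe x) (r * qI x) (r * qJ x) (r * qK x)"

instance
  by standard
    (simp_all add: quat_eq_iff zero_quat_def one_quat_def plus_quat_def uminus_quat_def
      minus_quat_def times_quat_def scaleR_quat_def algebra_simps)

end

definition qcnj :: "quat \<Rightarrow> quat" where
  "qcnj x = Quat (qRe x) (- qI x) (- qJ x) (- qK x)"


section \<open>Quaternionic hermitian and real symmetric matrices\<close>

definition conj_transpose :: "quat^'n^'m \<Rightarrow> quat^'m^'n" where
  "conj_transpose A = (\<chi> i j. qcnj (A $ j $ i))"

definition quat_hermitian :: "(quat^'n^'n) set" where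
  "quat_hermitian = {A. conj_transpose A = A}"

definition real_symmetric :: "(real^'n^'n) set" where
  "real_symmetric = {B. transpose B = B}"

text \<open>
  The condition \<open>v\<^sup>* A v \<ge> 0\<close> means that the quaternion \<open>v\<^sup>* A v\<close> is a nonnegative real number;
  \<open>\<real>\<^sub>\<ge>\<^sub>0\<close> is here the set of the nonnegative reals inside the quaternions.
\<close>

definition quat_psd :: "quat^'n^'n \<Rightarrow> bool" where
  "quat_psd A \<longleftrightarrow> A \<in> quat_hermitian \<and>
     (\<forall>v. (\<Sum>i\<in>UNIV. qcnj (v $ i) * (A *v v) $ i) \<in> \<real>\<^sub>\<ge>\<^sub>0)"


section \<open>The tensor product inside the quaternionic hermitian matrices\<close>

text \<open>
  The rows and columns of a Kronecker product are indexed by pairs, the first component being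
  the index of the block and the second one the position inside the block.
\<close>

definition kronecker :: "quat^'m^'m \<Rightarrow> real^'n^'n \<Rightarrow> quat^('m \<times> 'n)^('m \<times> 'n)" where
  "kronecker A B = (\<chi> i j. A $ fst i $ fst j * of_real (B $ snd i $ snd j))"

definition hermitian_tensor_symmetric ::
    "(quat^('m::finite \<times> 'n::finite)^('m \<times> 'n)) set" where
  "hermitian_tensor_symmetric =
     span {kronecker A B | A B. A \<in> quat_hermitian \<and> B \<in> real_symmetric}"

end

theory Submission
  imports Defs
begin

text \<open>
  Write a positive semidefinite element of the tensor product as
  \<open>A = P \<otimes> E\<^sub>1\<^sub>1 + H \<otimes> (E\<^sub>1\<^sub>2 + E\<^sub>2\<^sub>1) + R \<otimes> E\<^sub>2\<^sub>2\<close> with hermitian \<open>P\<close>, \<open>H\<close>, \<open>R\<close>; adding a small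
  multiple of the identity, \<open>P\<close> may be taken positive definite. The quadratic polynomial
  \<open>det (H - t P)\<close> has real roots \<open>d \<le> e\<close>, and \<open>H - d P\<close> and \<open>e P - H\<close> are positive semidefinite of
  rank at most one. Hence \<open>P = P\<^sub>1 + P\<^sub>2\<close> and \<open>H = d P\<^sub>1 + e P\<^sub>2\<close> with positive semidefinite
  \<open>P\<^sub>1\<close>, \<open>P\<^sub>2\<close>, and \<open>A\<close> is the sum of \<open>P\<^sub>1 \<otimes> (1,d)(1,d)\<^sup>T\<close>, \<open>P\<^sub>2 \<otimes> (1,e)(1,e)\<^sup>T\<close> and
  \<open>S \<otimes> E\<^sub>2\<^sub>2\<close>, where \<open>S\<close> is the Schur complement of \<open>P\<close>. So \<open>A\<close> is separable, and the transpose acts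
  on each term through \<open>2 \<times> 2\<close> quaternionic matrices, whose positivity is characterised by
  transpose-invariant conditions on diagonal and determinant.
\<close>

section \<open>Quaternion arithmetic and the squared norm\<close>

lemma quat_sel_simps [simp]:
  "qRe 0 = 0" "qI 0 = 0" "qJ 0 = 0" "qK 0 = 0"
  "qRe 1 = 1" "qI 1 = 0" "qJ 1 = 0" "qK 1 = 0"
  "qRe (x + y) = qRe x + qRe y" "qI (x + y) = qI x + qI y"
  "qJ (x + y) = qJ x + qJ y" "qK (x + y) = qK x + qK y"
  "qRe (x - y) = qRe x - qRe y" "qI (x - y) = qI x - qI y"
  "qJ (x - y) = qJ x - qJ y" "qK (x - y) = qK x - qK y"
  "qRe (- x) = - qRe x" "qI (- x) = - qI x" "qJ (- x) = - qJ x" "qK (- x) = - qK x"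
  "qRe (r *\<^sub>R x) = r * qRe x" "qI (r *\<^sub>R x) = r * qI x"
  "qJ (r *\<^sub>R x) = r * qJ x" "qK (r *\<^sub>R x) = r * qK x"
  "qRe (of_real r) = r" "qI (of_real r) = 0" "qJ (of_real r) = 0" "qK (of_real r) = 0"
  "qRe (qcnj x) = qRe x" "qI (qcnj x) = - qI x" "qJ (qcnj x) = - qJ x" "qK (qcnj x) = - qK x"
  by (simp_all add: zero_quat_def one_quat_def plus_quat_def minus_quat_def uminus_quat_def
      scaleR_quat_def of_real_def qcnj_def)

lemma quat_mult_sel:
  "qRe (x * y) = qRe x * qRe y - qI x * qI y - qJ x * qJ y - qK x * qK y"
  "qI (x * y) = qRe x * qI y + qI x * qRe y + qJ x * qK y - qK x * qJ y"
  "qJ (x * y) = qRe x * qJ y - qI x * qK y + qJ x * qRe y + qK x * qI y"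
  "qK (x * y) = qRe x * qK y + qI x * qJ y - qJ x * qI y + qK x * qRe y"
  by (simp_all add: times_quat_def)

lemma qcnj_simps [simp]:
  "qcnj 0 = 0"
  "qcnj (qcnj x) = x"
  "qcnj (of_real r) = of_real r"
  "qcnj (x + y) = qcnj x + qcnj y"
  "qcnj (x - y) = qcnj x - qcnj y"
  "qcnj (- x) = - qcnj x"
  "qcnj (r *\<^sub>R x) = r *\<^sub>R qcnj x"
  by (simp_all add: quat_eq_iff)

lemma qcnj_sum: "qcnj (sum f S) = (\<Sum>i\<in>S. qcnj (f i))"
  by (induction S rule: infinite_finite_induct) simp_all

definition qnormsq :: "quat \<Rightarrow> real" where
  "qnormsq x = (qRe x)\<^sup>2 + (qI x)\<^sup>2 + (qJ x)\<^sup>2 + (qK x)\<^sup>2"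

lemma qnormsq_nonneg [simp]: "0 \<le> qnormsq x"
  by (simp add: qnormsq_def)

lemma qnormsq_eq_0_iff [simp]: "qnormsq x = 0 \<longleftrightarrow> x = 0"
  by (auto simp: qnormsq_def quat_eq_iff add_nonneg_eq_0_iff)

lemma qnormsq_qcnj [simp]: "qnormsq (qcnj x) = qnormsq x"
  by (simp add: qnormsq_def)

text \<open>Euler's four-square identity.\<close>

lemma qnormsq_mult: "qnormsq (x * y) = qnormsq x * qnormsq y"
  by (simp add: qnormsq_def quat_mult_sel power2_eq_square algebra_simps)

lemma qRe_square_le: "(qRe x)\<^sup>2 \<le> qnormsq x"
  by (simp add: qnormsq_def)

lemma qcnj_mult_self: "qcnj x * x = of_real (qnormsq x)"
  by (simp add: quat_eq_iff quat_mult_sel qnormsq_def power2_eq_square)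

lemma quat_nonneg_Reals_iff:
  "x \<in> \<real>\<^sub>\<ge>\<^sub>0 \<longleftrightarrow> 0 \<le> qRe x \<and> qI x = 0 \<and> qJ x = 0 \<and> qK x = 0"
proof
  assume "x \<in> \<real>\<^sub>\<ge>\<^sub>0"
  then show "0 \<le> qRe x \<and> qI x = 0 \<and> qJ x = 0 \<and> qK x = 0"
    by (auto simp: nonneg_Reals_def)
next
  assume *: "0 \<le> qRe x \<and> qI x = 0 \<and> qJ x = 0 \<and> qK x = 0"
  then have "x = of_real (qRe x)"
    by (simp add: quat_eq_iff)
  with * show "x \<in> \<real>\<^sub>\<ge>\<^sub>0"
    unfolding nonneg_Reals_def by blast
qed


section \<open>Hermitian forms\<close>

definition qform :: "quat^'n^'n \<Rightarrow> quat^'n \<Rightarrow> quat" where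
  "qform A v = (\<Sum>i\<in>UNIV. qcnj (v $ i) * (A *v v) $ i)"

lemma qform_expand: "qform A v = (\<Sum>i\<in>UNIV. \<Sum>j\<in>UNIV. qcnj (v $ i) * (A $ i $ j * v $ j))"
  by (simp add: qform_def matrix_vector_mult_def sum_distrib_left)

lemma quat_psd_iff: "quat_psd A \<longleftrightarrow> A \<in> quat_hermitian \<and> (\<forall>v. qform A v \<in> \<real>\<^sub>\<ge>\<^sub>0)"
  by (simp add: quat_psd_def qform_def)

lemma qform_add: "qform (A + B) v = qform A v + qform B v"
  by (simp add: qform_def matrix_vector_mult_add_rdistrib distrib_left sum.distrib)

lemma qform_eq_0: "A *v v = 0 \<Longrightarrow> qform A v = 0"
  by (simp add: qform_def)

lemma mat_of_real_mult_vector: "mat (of_real r) *v v = r *\<^sub>R (v :: quat^'n)"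
  by (simp add: vec_eq_iff matrix_vector_mult_def mat_def mult_delta_left
      of_real_def)

lemma qform_mat: "qform (mat (of_real r)) v = of_real (r * (\<Sum>i\<in>UNIV. qnormsq (v $ i)))"
proof -
  have "qcnj (v $ i) * (mat (of_real r) *v v) $ i = of_real (r * qnormsq (v $ i))" for i
    unfolding mat_of_real_mult_vector
    by (simp add: qcnj_mult_self) (simp add: scaleR_conv_of_real)
  then show ?thesis
    by (simp add: qform_def sum_distrib_left)
qed

lemma quat_hermitian_iff: "A \<in> quat_hermitian \<longleftrightarrow> (\<forall>i j. qcnj (A $ j $ i) = A $ i $ j)"
  by (auto simp: quat_hermitian_def conj_transpose_def vec_eq_iff)

lemma quat_hermitianD: "A \<in> quat_hermitian \<Longrightarrow> A $ i $ j = qcnj (A $ j $ i)"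
  by (simp add: quat_hermitian_iff)

lemma subspace_quat_hermitian: "subspace quat_hermitian"
  by (simp add: subspace_def quat_hermitian_iff)

lemmas quat_hermitian_add = subspace_add[OF subspace_quat_hermitian]
  and quat_hermitian_diff = subspace_diff[OF subspace_quat_hermitian]
  and quat_hermitian_scaleR = subspace_mul[OF subspace_quat_hermitian]

lemma quat_hermitian_mat: "mat (of_real r) \<in> quat_hermitian"
  by (simp add: quat_hermitian_iff mat_def)

lemma quat_hermitian_transpose: "A \<in> quat_hermitian \<Longrightarrow> transpose A \<in> quat_hermitian"
  by (simp add: quat_hermitian_iff transpose_def)

lemma quat_psd_add: "quat_psd A \<Longrightarrow> quat_psd B \<Longrightarrow> quat_psd (A + B)"
  by (simp add: quat_psd_iff qform_add quat_hermitian_add)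

lemma quat_psd_mat: "0 \<le> r \<Longrightarrow> quat_psd (mat (of_real r))"
  unfolding quat_psd_iff qform_mat
  by (simp add: quat_hermitian_mat quat_nonneg_Reals_iff sum_nonneg del: of_real_mult of_real_sum)

text \<open>\<open>qform (A + mat (of_real r)) v\<close> is affine in \<open>r\<close>, with slope
  the squared length of \<open>v\<close>; let \<open>r\<close> tend to 0.\<close>

lemma quat_psd_limit:
  assumes "\<And>r. 0 < r \<Longrightarrow> quat_psd (A + mat (of_real r))"
  shows "quat_psd A"
proof -
  have "A = (A + mat (of_real 1)) - mat (of_real 1)"
    by simp
  then have "A \<in> quat_hermitian"
    by (metis assms quat_psd_iff quat_hermitian_diff quat_hermitian_mat zero_less_one)
  moreover have "qform A v \<in> \<real>\<^sub>\<ge>\<^sub>0" for v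
  proof -
    let ?n = "\<Sum>i\<in>UNIV. qnormsq (v $ i)"
    have *: "0 \<le> qRe (qform A v) + r * ?n" "qI (qform A v) = 0" "qJ (qform A v) = 0"
      "qK (qform A v) = 0" if "0 < r" for r
      using assms[OF that]
      by (simp_all add: quat_psd_iff qform_add qform_mat quat_nonneg_Reals_iff
          del: of_real_mult of_real_sum)
    have "0 \<le> qRe (qform A v)"
    proof (rule field_le_epsilon)
      fix e :: real
      assume "0 < e"
      have n: "0 \<le> ?n"
        by (simp add: sum_nonneg)
      \<comment> \<open>The summand 1 keeps the divisor positive when \<open>v = 0\<close>.\<close>
      have "0 < e / (?n + 1)"
        using n \<open>0 < e\<close> by simp
      moreover have "e / (?n + 1) * ?n \<le> e"
        using n \<open>0 < e\<close> by (simp add: field_simps)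
      ultimately show "0 \<le> qRe (qform A v) + e"
        using *(1)[of "e / (?n + 1)"] by linarith
    qed
    with *(2-4)[of 1] show ?thesis
      by (simp add: quat_nonneg_Reals_iff)
  qed
  ultimately show ?thesis
    by (simp add: quat_psd_iff)
qed


section \<open>Two by two matrices\<close>

text \<open>For hermitian \<open>P\<close> this is the Moore determinant: the off-diagonal entries
  are conjugate, so their product is a squared norm.\<close>

definition qdet :: "quat^2^2 \<Rightarrow> real" where
  "qdet P = qRe (P $ 1 $ 1) * qRe (P $ 2 $ 2) - qnormsq (P $ 1 $ 2)"

text \<open>The adjugate as trace minus matrix, the form suggested by Cayley-Hamilton.\<close>

definition qadj :: "quat^2^2 \<Rightarrow> quat^2^2" where
  "qadj P = mat (P $ 1 $ 1 + P $ 2 $ 2) - P"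

lemma quat_hermitian_2E:
  fixes P :: "quat^2^2"
  assumes "P \<in> quat_hermitian"
  obtains a b where "P $ 1 $ 1 = of_real a" "P $ 2 $ 2 = of_real b" "P $ 2 $ 1 = qcnj (P $ 1 $ 2)"
proof
  show "P $ 1 $ 1 = of_real (qRe (P $ 1 $ 1))" "P $ 2 $ 2 = of_real (qRe (P $ 2 $ 2))"
    "P $ 2 $ 1 = qcnj (P $ 1 $ 2)"
    using quat_hermitianD[OF assms, of 1 1] quat_hermitianD[OF assms, of 2 2]
      quat_hermitianD[OF assms, of 2 1]
    by (simp_all add: quat_eq_iff)
qed

lemma qform_2:
  fixes P :: "quat^2^2"
  assumes "P \<in> quat_hermitian"
  shows "qform P x = of_real (qRe (P $ 1 $ 1) * qnormsq (x $ 1) + qRe (P $ 2 $ 2) * qnormsq (x $ 2)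
           + 2 * qRe (qcnj (x $ 1) * (P $ 1 $ 2 * x $ 2)))"
  using assms
proof (rule quat_hermitian_2E)
  fix a b
  assume P: "P $ 1 $ 1 = of_real a" "P $ 2 $ 2 = of_real b" "P $ 2 $ 1 = qcnj (P $ 1 $ 2)"
  show ?thesis
    unfolding qform_expand sum_2 P
    by (simp add: quat_eq_iff quat_mult_sel qnormsq_def power2_eq_square algebra_simps
        del: of_real_add of_real_mult)
qed

text \<open>Test vectors give the three inequalities. Conversely, multiplicativity of the squared
  norm and AM-GM bound the cross term by the two diagonal terms.\<close>

lemma quat_psd_2_iff:
  fixes P :: "quat^2^2"
  shows "quat_psd P \<longleftrightarrow>
    P \<in> quat_hermitian \<and> 0 \<le> qRe (P $ 1 $ 1) \<and> 0 \<le> qRe (P $ 2 $ 2) \<and> 0 \<le> qdet P"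
    (is "_ \<longleftrightarrow> ?R")
proof
  assume "quat_psd P"
  let ?a = "qRe (P $ 1 $ 1)" and ?b = "qRe (P $ 2 $ 2)" and ?q = "P $ 1 $ 2"
  have herm: "P \<in> quat_hermitian"
    using \<open>quat_psd P\<close> by (simp add: quat_psd_iff)
  have pos: "0 \<le> ?a * qnormsq x + ?b * qnormsq y + 2 * qRe (qcnj x * (?q * y))" for x y
    using \<open>quat_psd P\<close> qform_2[OF herm, of "vector [x, y]"]
    unfolding quat_psd_iff quat_nonneg_Reals_iff
    by (metis quat_sel_simps(25) vector_2)
  have a: "0 \<le> ?a" and b: "0 \<le> ?b"
    using pos[of 1 0] pos[of 0 1] by (simp_all add: qnormsq_def)
  \<comment> \<open>A first coordinate along \<open>?q\<close> turns the cross term into a real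
    multiple of \<open>qnormsq ?q\<close>.\<close>
  have q: "?a * (t\<^sup>2 * qnormsq ?q) + ?b * s\<^sup>2 - 2 * (t * s * qnormsq ?q) \<ge> 0" for t s
    using pos[of "- (t *\<^sub>R ?q)" "of_real s"]
    by (simp add: qnormsq_def quat_mult_sel power2_eq_square algebra_simps)
  have "qnormsq ?q \<le> ?a * ?b"
  proof (cases "?a = 0")
    case True
    have "qnormsq ?q = 0"
    proof (rule ccontr)
      assume "qnormsq ?q \<noteq> 0"
      \<comment> \<open>With \<open>?a = 0\<close> and \<open>s = 1\<close> the expression is linear
        in \<open>t\<close>; this \<open>t\<close> gives it the value -1.\<close>
      then show False
        using q[of "(?b + 1) / (2 * qnormsq ?q)" 1] True by simp
    qed
    with True show ?thesis
      by (simp del: qnormsq_eq_0_iff)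
  next
    case False
    \<comment> \<open>For \<open>s = ?a\<close> the expression is smallest at
      \<open>t = 1\<close>.\<close>
    have "?a * (?a * ?b - qnormsq ?q) \<ge> 0"
      using q[of 1 ?a] by (simp add: power2_eq_square algebra_simps)
    with a False show ?thesis
      by (simp add: zero_le_mult_iff)
  qed
  with a b herm show ?R
    by (simp add: qdet_def)
next
  assume R: ?R
  let ?a = "qRe (P $ 1 $ 1)" and ?b = "qRe (P $ 2 $ 2)" and ?q = "P $ 1 $ 2"
  have "0 \<le> ?a * qnormsq (x $ 1) + ?b * qnormsq (x $ 2) + 2 * qRe (qcnj (x $ 1) * (?q * x $ 2))"
    for x :: "quat^2"
  proof -
    let ?s = "?a * qnormsq (x $ 1)" and ?t = "?b * qnormsq (x $ 2)"
      and ?z = "qRe (qcnj (x $ 1) * (?q * x $ 2))"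
    have "?z\<^sup>2 \<le> qnormsq (x $ 1) * (qnormsq ?q * qnormsq (x $ 2))"
      using qRe_square_le[of "qcnj (x $ 1) * (?q * x $ 2)"] by (simp add: qnormsq_mult)
    also have "\<dots> \<le> qnormsq (x $ 1) * (?a * ?b * qnormsq (x $ 2))"
      using R by (intro mult_left_mono mult_right_mono) (auto simp: qdet_def)
    finally have "(2 * ?z)\<^sup>2 \<le> 4 * (?s * ?t)"
      by (simp add: power2_eq_square mult_ac)
    also have "\<dots> \<le> (?s + ?t)\<^sup>2"
      using sum_squares_bound[of ?s ?t] by (simp add: power2_sum mult_ac)
    finally have "\<bar>2 * ?z\<bar> \<le> \<bar>?s + ?t\<bar>"
      by (simp only: abs_le_square_iff)
    moreover have "0 \<le> ?s + ?t"
      using R by simp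
    ultimately have "\<bar>2 * ?z\<bar> \<le> ?s + ?t"
      by linarith
    then show ?thesis
      by linarith
  qed
  with R show "quat_psd P"
    by (simp add: quat_psd_iff qform_2 quat_nonneg_Reals_iff del: of_real_add of_real_mult)
qed

text \<open>Transposing a hermitian matrix conjugates its off-diagonal entries, which leaves the
  diagonal and \<open>qdet\<close> unchanged.\<close>

lemma quat_psd_transpose_2:
  fixes P :: "quat^2^2"
  assumes "quat_psd P"
  shows "quat_psd (transpose P)"
proof -
  have herm: "P \<in> quat_hermitian"
    using assms by (simp add: quat_psd_iff)
  have "qdet (transpose P) = qdet P"
    by (simp add: qdet_def transpose_def quat_hermitianD[OF herm, of 2 1])
  with assms show ?thesis
    unfolding quat_psd_2_iff by (simp add: quat_hermitian_transpose) (simp add: transpose_def)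
qed

section \<open>Adjugates, kernels and simultaneous decomposition\<close>

lemma qadj_mult:
  assumes "P \<in> quat_hermitian"
  shows "qadj P ** P = mat (of_real (qdet P))" "P ** qadj P = mat (of_real (qdet P))"
proof -
  obtain a b where P: "P $ 1 $ 1 = of_real a" "P $ 2 $ 2 = of_real b"
      "P $ 2 $ 1 = qcnj (P $ 1 $ 2)"
    using assms by (rule quat_hermitian_2E)
  show "qadj P ** P = mat (of_real (qdet P))" "P ** qadj P = mat (of_real (qdet P))"
    unfolding vec_eq_iff forall_2
    by (simp_all add: matrix_matrix_mult_def sum_2 qadj_def mat_def qdet_def P)
      (simp_all add: quat_eq_iff quat_mult_sel qnormsq_def power2_eq_square algebra_simps)
qed

lemma qadj_add: "qadj (P + Q) = qadj P + qadj Q"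
  by (simp add: qadj_def mat_def vec_eq_iff)

lemma matrix_vector_mult_scaleR_quat:
  fixes A :: "quat^'n^'m"
  shows "A *v (r *\<^sub>R v) = r *\<^sub>R (A *v v)"
  by (simp add: matrix_vector_mult_def vec_eq_iff scaleR_sum_right)

text \<open>\<open>qadj (P + Q) ** (P + Q)\<close> is a nonzero multiple of the identity. On
  expansion \<open>qadj P ** P\<close> and \<open>qadj Q ** Q\<close> vanish; the two mixed terms
  remain, one annihilated by \<open>Q\<close> and one by \<open>P\<close>, since
  \<open>Q ** qadj Q\<close> and \<open>P ** qadj P\<close> vanish too.\<close>

lemma kernel_decomposition:
  assumes "P \<in> quat_hermitian" "Q \<in> quat_hermitian" "qdet P = 0" "qdet Q = 0" "qdet (P + Q) \<noteq> 0"
  obtains u w where "y = u + w" "Q *v u = 0" "P *v w = 0"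
proof
  let ?c = "inverse (qdet (P + Q))"
  let ?u = "?c *\<^sub>R (qadj Q *v (P *v y))" and ?w = "?c *\<^sub>R (qadj P *v (Q *v y))"
  have zero: "mat 0 *v v = 0" for v :: "quat^2"
    using mat_of_real_mult_vector[of 0 v] by simp
  show "Q *v ?u = 0" "P *v ?w = 0"
    using assms by (simp_all add: matrix_vector_mult_scaleR_quat matrix_vector_mul_assoc
        qadj_mult zero matrix_mul_assoc)
  have "qadj (P + Q) ** (P + Q) = mat (of_real (qdet (P + Q)))"
    using assms by (simp add: qadj_mult quat_hermitian_add)
  then have "qdet (P + Q) *\<^sub>R y = qadj (P + Q) *v ((P + Q) *v y)"
    by (simp add: matrix_vector_mul_assoc mat_of_real_mult_vector)
  also have "\<dots> = qadj Q *v (P *v y) + qadj P *v (Q *v y)"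
    using assms
    by (simp add: qadj_add matrix_vector_mult_add_rdistrib matrix_vector_right_distrib)
      (simp add: matrix_vector_mul_assoc qadj_mult zero)
  finally show "y = ?u + ?w"
    using assms(5) by (metis scaleR_add_right scaleR_scaleR left_inverse scaleR_one)
qed

text \<open>
  The last conclusion makes the two squares in the Schur complement computation vanish
  simultaneously.
\<close>

lemma simultaneous_decomposition:
  fixes P H :: "quat^2^2"
  assumes P: "P \<in> quat_hermitian" "0 < qRe (P $ 1 $ 1)" "0 < qRe (P $ 2 $ 2)" "0 < qdet P"
    and H: "H \<in> quat_hermitian"
  obtains P1 P2 d e where "quat_psd P1" "quat_psd P2" "P = P1 + P2" "H = d *\<^sub>R P1 + e *\<^sub>R P2"
    "\<And>y. \<exists>x. P1 *v (x + d *\<^sub>R y) = 0 \<and> P2 *v (x + e *\<^sub>R y) = 0"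
proof -
  define a b where "a = qRe (P $ 1 $ 1)" and "b = qRe (P $ 2 $ 2)"
  define a' b' where "a' = qRe (H $ 1 $ 1)" and "b' = qRe (H $ 2 $ 2)"
  define f where "f t = qdet (H - t *\<^sub>R P)" for t
  define c where "c = qdet P"
  \<comment> \<open>\<open>m\<close> is the polarization of \<open>qdet\<close> at \<open>P\<close>
    and \<open>H\<close>, and \<open>D\<close> the discriminant of the quadratic
    \<open>f\<close>.\<close>
  define m where "m = a * b' + b * a' - 2 * qRe (qcnj (P $ 1 $ 2) * H $ 1 $ 2)"
  define D where "D = m\<^sup>2 - 4 * c * qdet H"
  have pos: "a > 0" "b > 0" "c > 0"
    using P by (simp_all add: a_def b_def c_def)
  have f_eq: "f t = c * t\<^sup>2 - m * t + qdet H" for t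
    by (simp add: f_def c_def m_def qdet_def a_def b_def a'_def b'_def qnormsq_def quat_mult_sel
        power2_eq_square algebra_simps)
  have f_square: "4 * c * f t = (2 * c * t - m)\<^sup>2 - D" for t
    by (simp add: f_eq D_def power2_eq_square algebra_simps)
  \<comment> \<open>At \<open>a' / a\<close> the first diagonal entry of
    \<open>H - t *\<^sub>R P\<close> vanishes, so the determinant is minus a squared norm; likewise
    at \<open>b' / b\<close> for the second one. As \<open>c > 0\<close>, the roots of
    \<open>f\<close> are real.\<close>
  have f_a: "f (a' / a) = - qnormsq (H $ 1 $ 2 - (a' / a) *\<^sub>R P $ 1 $ 2)"
    using pos by (simp add: f_def qdet_def a_def a'_def)
  have f_b: "f (b' / b) = - qnormsq (H $ 1 $ 2 - (b' / b) *\<^sub>R P $ 1 $ 2)"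
    using pos by (simp add: f_def qdet_def b_def b'_def)
  have le: "f (a' / a) \<le> 0" "f (b' / b) \<le> 0"
    unfolding f_a f_b by simp_all
  have bound: "(2 * c * t - m)\<^sup>2 \<le> D" if "f t \<le> 0" for t
  proof -
    have "4 * c * f t \<le> 0"
      using pos that by (simp add: mult_le_0_iff)
    then show ?thesis
      using f_square[of t] by linarith
  qed
  have "0 \<le> D"
    using bound[OF le(1)] zero_le_power2 order_trans by blast
  show ?thesis
  proof (cases "D = 0")
    case True
    let ?d = "m / (2 * c)"
    \<comment> \<open>With a double root, \<open>f t \<le> 0\<close> forces both diagonal ratios to
      equal \<open>?d\<close>; \<open>f ?d = 0\<close> then settles the off-diagonal entry, and
      \<open>H\<close> is a multiple of \<open>P\<close>.\<close>
    have eq: "t = ?d" if "f t \<le> 0" for t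
      using bound[OF that] True pos by (simp add: field_simps)
    have "f ?d = 0"
      using f_square[of ?d] True pos by simp
    with f_a eq[OF le(1)] have "H $ 1 $ 2 = ?d *\<^sub>R P $ 1 $ 2"
      by simp
    moreover have "a' = ?d * a" "b' = ?d * b"
      using eq[OF le(1)] eq[OF le(2)] pos by (simp_all add: field_simps)
    ultimately have "H = ?d *\<^sub>R P"
      using quat_hermitian_2E[OF P(1)] quat_hermitian_2E[OF H]
      unfolding vec_eq_iff forall_2 a_def b_def a'_def b'_def
      by (smt (verit) qcnj_simps(7) quat_sel_simps(25) of_real_mult scaleR_conv_of_real
          vector_scaleR_component)
    moreover have "quat_psd P"
      using P by (simp add: quat_psd_2_iff)
    moreover have "quat_psd (0 :: quat^2^2)"
      using quat_psd_mat[of 0] by (simp add: mat_def zero_vec_def)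
    \<comment> \<open>The second summand is zero; the required \<open>x\<close> is the negative of
      \<open>?d *\<^sub>R y\<close>.\<close>
    ultimately show ?thesis
      using that[of P 0 ?d ?d]
      by (metis add.right_neutral add_eq_0_iff matrix_vector_mult_0_right scaleR_zero_right
          ab_group_add_class.ab_left_minus)
  next
    case False
    define s where "s = sqrt D"
    have s: "0 < s" "s\<^sup>2 = D"
      using \<open>0 \<le> D\<close> False by (simp_all add: s_def)
    define d e where "d = (m - s) / (2 * c)" and "e = (m + s) / (2 * c)"
    have "d < e"
      using s pos by (simp add: d_def e_def divide_strict_right_mono)
    have root: "f d = 0" "f e = 0"
      using f_square[of d] f_square[of e] s pos by (simp_all add: d_def e_def)
    have between: "d \<le> t" "t \<le> e" if "f t \<le> 0" for t
    proof -
      have "\<bar>2 * c * t - m\<bar> \<le> s"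
        using bound[OF that] by (simp add: s_def real_le_rsqrt)
      then show "d \<le> t" "t \<le> e"
        using pos by (auto simp: d_def e_def field_simps abs_le_iff)
    qed
    define k where "k = inverse (e - d)"
    have k: "0 < k" "k * (e - d) = 1"
      using \<open>d < e\<close> by (simp_all add: k_def)
    \<comment> \<open>The solution of the linear system formed by \<open>sum\<close> and
      \<open>comb\<close>.\<close>
    define P1 P2 where "P1 = k *\<^sub>R (e *\<^sub>R P - H)" and "P2 = k *\<^sub>R (H - d *\<^sub>R P)"
    have sum: "P = P1 + P2"
    proof -
      have "P1 + P2 = (k * (e - d)) *\<^sub>R P"
        by (simp add: P1_def P2_def vec_eq_iff algebra_simps)
      then show ?thesis
        using k by simp
    qed
    have comb: "H = d *\<^sub>R P1 + e *\<^sub>R P2"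
    proof -
      have "d *\<^sub>R P1 + e *\<^sub>R P2 = (k * (e - d)) *\<^sub>R H"
        by (simp add: P1_def P2_def vec_eq_iff algebra_simps)
      then show ?thesis
        using k by simp
    qed
    have herm: "P1 \<in> quat_hermitian" "P2 \<in> quat_hermitian"
      by (simp_all add: P1_def P2_def P(1) H quat_hermitian_diff quat_hermitian_scaleR)
    have "qdet P1 = k\<^sup>2 * f e" "qdet P2 = k\<^sup>2 * f d"
      by (simp_all add: P1_def P2_def f_def qdet_def qnormsq_def power2_eq_square algebra_simps)
    then have det: "qdet P1 = 0" "qdet P2 = 0"
      using root by simp_all
    \<comment> \<open>The ratios \<open>a' / a\<close> and \<open>b' / b\<close> lie between the
      roots, so \<open>P1\<close> and \<open>P2\<close> have nonnegative diagonals.\<close>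
    have "d * a \<le> a'" "a' \<le> e * a" "d * b \<le> b'" "b' \<le> e * b"
      using between[OF le(1)] between[OF le(2)] pos by (simp_all add: field_simps)
    then have psd: "quat_psd P1" "quat_psd P2"
      using herm det k
      by (simp_all add: quat_psd_2_iff P1_def P2_def a_def b_def a'_def b'_def)
    have "\<exists>x. P1 *v (x + d *\<^sub>R y) = 0 \<and> P2 *v (x + e *\<^sub>R y) = 0" for y
    proof -
      obtain u w where y: "y = u + w" and uw: "P2 *v u = 0" "P1 *v w = 0"
        using kernel_decomposition[OF herm det] P(4) sum by (metis less_irrefl)
      \<comment> \<open>\<open>?x\<close> cancels the \<open>u\<close> part of
        \<open>d *\<^sub>R y\<close> and the \<open>w\<close> part of \<open>e *\<^sub>R y\<close>,
        leaving vectors in the kernels of \<open>P1\<close> and \<open>P2\<close>.\<close>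
      let ?x = "- (d *\<^sub>R u + e *\<^sub>R w)"
      have "?x + d *\<^sub>R y = (d - e) *\<^sub>R w" "?x + e *\<^sub>R y = (e - d) *\<^sub>R u"
        by (simp_all add: y algebra_simps)
      then show ?thesis
        using uw by (metis matrix_vector_mult_scaleR_quat scaleR_zero_right)
    qed
    then show ?thesis
      using that psd sum comb by blast
  qed
qed


section \<open>Separability\<close>

definition outer :: "real^'n \<Rightarrow> real^'n^'n" where
  "outer b = (\<chi> p q. b $ p * b $ q)"

text \<open>The real factor is symmetric, so transposition reaches only the quaternionic
  one.\<close>

lemma transpose_kronecker_outer:
  "transpose (kronecker P (outer b)) = kronecker (transpose P) (outer b)"
  by (simp add: vec_eq_iff transpose_def kronecker_def outer_def of_real_def mult.commute)

lemma sum_UNIV_prod: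
  "(\<Sum>i\<in>UNIV. f i) = (\<Sum>i\<in>(UNIV :: 'm::finite set). \<Sum>p\<in>(UNIV :: 'n::finite set). f (i, p))"
  by (simp add: sum.cartesian_product)

text \<open>Real scalars are central, so \<open>b $ p\<close> and \<open>b $ q\<close> can be moved
  onto the two copies of \<open>v\<close>, contracting its second index against
  \<open>b\<close>.\<close>

lemma qform_kronecker_outer:
  fixes P :: "quat^'m::finite^'m" and b :: "real^'n::finite"
  shows "qform (kronecker P (outer b)) v = qform P (\<chi> i. \<Sum>p\<in>UNIV. b $ p *\<^sub>R v $ (i, p))"
proof -
  have "qform (kronecker P (outer b)) v = (\<Sum>i\<in>UNIV. \<Sum>p\<in>UNIV. \<Sum>j\<in>UNIV. \<Sum>q\<in>UNIV.
      (b $ p *\<^sub>R qcnj (v $ (i, p))) * (P $ i $ j * (b $ q *\<^sub>R v $ (j, q))))"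
    unfolding qform_expand sum_UNIV_prod
    by (intro sum.cong refl) (simp add: kronecker_def outer_def of_real_def mult_ac)
  also have "\<dots> = (\<Sum>i\<in>UNIV. \<Sum>j\<in>UNIV. \<Sum>p\<in>UNIV. \<Sum>q\<in>UNIV.
      (b $ p *\<^sub>R qcnj (v $ (i, p))) * (P $ i $ j * (b $ q *\<^sub>R v $ (j, q))))"
    by (intro sum.cong refl sum.swap)
  also have "\<dots> = qform P (\<chi> i. \<Sum>p\<in>UNIV. b $ p *\<^sub>R v $ (i, p))"
    unfolding qform_expand vec_lambda_beta
    by (intro sum.cong refl)
      (simp only: sum_distrib_left[of "P $ i $ j" for i j] sum_product qcnj_sum qcnj_simps)
  finally show ?thesis .
qed

lemma quat_hermitian_kronecker:
  assumes "P \<in> quat_hermitian" "B \<in> real_symmetric"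
  shows "kronecker P B \<in> quat_hermitian"
proof -
  have "B $ p $ q = B $ q $ p" for p q
    using assms(2) by (metis (mono_tags) real_symmetric_def mem_Collect_eq transpose_def vec_lambda_beta)
  then show ?thesis
    using assms(1) unfolding quat_hermitian_iff kronecker_def
    by (simp add: of_real_def)
qed

lemma outer_real_symmetric: "outer b \<in> real_symmetric"
  by (simp add: real_symmetric_def outer_def transpose_def vec_eq_iff mult.commute)

lemma quat_psd_kronecker_outer:
  fixes P :: "quat^'m::finite^'m" and b :: "real^'n::finite"
  assumes "quat_psd P"
  shows "quat_psd (kronecker P (outer b))"
  using assms
  by (simp add: quat_psd_iff qform_kronecker_outer quat_hermitian_kronecker outer_real_symmetric)

text \<open>A vector supported on the positions with second index \<open>p\<close> sees only this
  principal submatrix.\<close>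

lemma quat_psd_diagonal_part:
  fixes A :: "quat^('m::finite \<times> 'n::finite)^('m \<times> 'n)"
  assumes "quat_psd A"
  shows "quat_psd (\<chi> i j. A $ (i, p) $ (j, p))"
  unfolding quat_psd_iff
proof
  show "(\<chi> i j. A $ (i, p) $ (j, p)) \<in> quat_hermitian"
    using assms by (simp add: quat_psd_iff quat_hermitian_iff)
  have "qform (\<chi> i j. A $ (i, p) $ (j, p)) x
      = qform A (\<chi> k. if snd k = p then x $ fst k else 0)" for x
    unfolding qform_expand sum_UNIV_prod
    by (simp add: if_distrib[of qcnj] mult_delta_left mult_delta_right cong: if_cong,
        intro sum.cong refl, subst sum.swap, simp)
  then show "\<forall>x. qform (\<chi> i j. A $ (i, p) $ (j, p)) x \<in> \<real>\<^sub>\<ge>\<^sub>0"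
    using assms by (simp add: quat_psd_iff)
qed

section \<open>Blockwise symmetry and the transpose\<close>

definition block_symmetric :: "(quat^('m::finite \<times> 'n::finite)^('m \<times> 'n)) set" where
  "block_symmetric = {A. \<forall>i j p q. A $ (i, p) $ (j, q) = A $ (i, q) $ (j, p)}"

lemma subspace_block_symmetric: "subspace block_symmetric"
  unfolding subspace_def block_symmetric_def by simp

text \<open>Both properties are linear and hold for the generators, so they pass to the
  span.\<close>

lemma hermitian_tensor_symmetric_subset:
  "hermitian_tensor_symmetric \<subseteq> quat_hermitian \<inter> block_symmetric"
  unfolding hermitian_tensor_symmetric_def
proof (rule span_minimal)
  have "kronecker P B \<in> block_symmetric" if "B \<in> real_symmetric" for P :: "quat^'m^'m" and B :: "real^'n^'n"
  proof -
    have "B $ p $ q = B $ q $ p" for p q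
      using that by (metis (mono_tags) real_symmetric_def mem_Collect_eq transpose_def vec_lambda_beta)
    then show ?thesis
      unfolding block_symmetric_def kronecker_def by simp
  qed
  then show "{kronecker A B |A B. A \<in> quat_hermitian \<and> B \<in> real_symmetric}
      \<subseteq> quat_hermitian \<inter> block_symmetric"
    by (auto intro: quat_hermitian_kronecker)
  show "subspace (quat_hermitian \<inter> block_symmetric)"
    by (intro subspace_inter subspace_quat_hermitian subspace_block_symmetric)
qed

text \<open>The strict inequalities make the coefficient of \<open>E11\<close> positive definite, as
  the simultaneous decomposition demands.\<close>

lemma quat_psd_transpose_of_pos_det:
  fixes A :: "quat^(2 \<times> 2)^(2 \<times> 2)"
  assumes psd: "quat_psd A" and sym: "A \<in> block_symmetric"
    and pos: "0 < qRe (A $ (1, 1) $ (1, 1))" "0 < qRe (A $ (2, 1) $ (2, 1))"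
      "0 < qdet (\<chi> i j. A $ (i, 1) $ (j, 1))"
  shows "quat_psd (transpose A)"
proof -
  define P where "P = (\<chi> i j. A $ (i, 1) $ (j, 1))"
  define H where "H = (\<chi> i j. A $ (i, 1) $ (j, 2))"
  define R where "R = (\<chi> i j. A $ (i, 2) $ (j, 2))"
  have herm: "qcnj (A $ l $ k) = A $ k $ l" for k l
    using psd unfolding quat_psd_iff quat_hermitian_iff by blast
  have swap: "A $ (i, p) $ (j, q) = A $ (i, q) $ (j, p)" for i j p q
    using sym by (simp add: block_symmetric_def)
  \<comment> \<open>For \<open>H\<close>, conjugate transposition exchanges the second indices 1 and
    2, and \<open>swap\<close> exchanges them back.\<close>
  have herms: "P \<in> quat_hermitian" "H \<in> quat_hermitian" "R \<in> quat_hermitian"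
    using herm swap by (auto simp: quat_hermitian_iff P_def H_def R_def)
  have pd: "0 < qRe (P $ 1 $ 1)" "0 < qRe (P $ 2 $ 2)" "0 < qdet P"
    using pos by (simp_all add: P_def)
  obtain P1 P2 d e where P12: "quat_psd P1" "quat_psd P2" "P = P1 + P2"
      "H = d *\<^sub>R P1 + e *\<^sub>R P2"
    and ker: "\<And>y. \<exists>x. P1 *v (x + d *\<^sub>R y) = 0 \<and> P2 *v (x + e *\<^sub>R y) = 0"
    using simultaneous_decomposition[OF herms(1) pd herms(2)] by blast
  \<comment> \<open>The first two summands already contribute
    \<open>d\<^sup>2 *\<^sub>R P1 + e\<^sup>2 *\<^sub>R P2\<close> to \<open>R\<close>;
    \<open>S\<close> is the remainder.\<close>
  define S where "S = R - d\<^sup>2 *\<^sub>R P1 - e\<^sup>2 *\<^sub>R P2"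
  let ?b1 = "vector [1, d] :: real^2" and ?b2 = "vector [1, e] :: real^2"
    and ?b3 = "vector [0, 1] :: real^2"
  have A_eq: "A = kronecker P1 (outer ?b1) + kronecker P2 (outer ?b2) + kronecker S (outer ?b3)"
  proof -
    have P_ent: "A $ (i, 1) $ (j, 1) = P1 $ i $ j + P2 $ i $ j" for i j
      using arg_cong[OF P12(3), of "\<lambda>M. M $ i $ j"] by (simp add: P_def)
    have H_ent: "A $ (i, 1) $ (j, 2) = d *\<^sub>R P1 $ i $ j + e *\<^sub>R P2 $ i $ j" for i j
      using arg_cong[OF P12(4), of "\<lambda>M. M $ i $ j"] by (simp add: H_def)
    have "A $ (i, p) $ (j, q) = (kronecker P1 (outer ?b1) + kronecker P2 (outer ?b2)
        + kronecker S (outer ?b3)) $ (i, p) $ (j, q)" for i j p q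
      using exhaust_2[of p] exhaust_2[of q]
      by (auto simp: kronecker_def outer_def P_ent H_ent swap[of i 2 j 1] S_def R_def of_real_def
          power2_eq_square)
    then show ?thesis
      unfolding vec_eq_iff by simp
  qed
  have "quat_psd S"
    unfolding quat_psd_iff
  proof (intro conjI allI)
    show "S \<in> quat_hermitian"
      unfolding S_def using P12 herms
      by (intro quat_hermitian_diff quat_hermitian_scaleR) (simp_all add: quat_psd_iff)
    fix y
    obtain x where x: "P1 *v (x + d *\<^sub>R y) = 0" "P2 *v (x + e *\<^sub>R y) = 0"
      using ker by blast
    \<comment> \<open>Contracting \<open>v\<close> with \<open>?b1\<close> and \<open>?b2\<close>
      gives kernel vectors of \<open>P1\<close> and \<open>P2\<close>, and with \<open>?b3\<close>
      gives \<open>y\<close>. So only the \<open>S\<close> term of \<open>qform A v\<close>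
      survives.\<close>
    define v :: "quat^(2 \<times> 2)" where "v = (\<chi> k. if snd k = 1 then x $ fst k else y $ fst k)"
    have "(\<chi> i. \<Sum>p\<in>UNIV. vector [s, t] $ p *\<^sub>R v $ (i, p)) = s *\<^sub>R x + t *\<^sub>R y" for s t
      by (simp add: vec_eq_iff sum_2 v_def)
    then have "qform A v = qform P1 (x + d *\<^sub>R y) + qform P2 (x + e *\<^sub>R y) + qform S y"
      unfolding A_eq by (simp add: qform_add qform_kronecker_outer)
    then have "qform A v = qform S y"
      using x by (simp add: qform_eq_0)
    then show "qform S y \<in> \<real>\<^sub>\<ge>\<^sub>0"
      using psd by (metis quat_psd_iff)
  qed
  moreover have "transpose A = kronecker (transpose P1) (outer ?b1)
      + kronecker (transpose P2) (outer ?b2) + kronecker (transpose S) (outer ?b3)"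
    unfolding transpose_kronecker_outer[symmetric]
    by (subst A_eq) (simp add: vec_eq_iff transpose_def)
  ultimately show ?thesis
    using P12 by (simp add: quat_psd_add quat_psd_kronecker_outer quat_psd_transpose_2)
qed

lemma quat_psd_transpose:
  fixes A :: "quat^(2 \<times> 2)^(2 \<times> 2)"
  assumes psd: "quat_psd A" and sym: "A \<in> block_symmetric"
  shows "quat_psd (transpose A)"
proof (rule quat_psd_limit)
  fix r :: real
  assume "0 < r"
  let ?B = "A + mat (of_real r)"
  have "quat_psd (\<chi> i j. A $ (i, 1) $ (j, 1))"
    using psd by (rule quat_psd_diagonal_part)
  then have diag: "0 \<le> qRe (A $ (1, 1) $ (1, 1))" "0 \<le> qRe (A $ (2, 1) $ (2, 1))"
    "qnormsq (A $ (1, 1) $ (2, 1)) \<le> qRe (A $ (1, 1) $ (1, 1)) * qRe (A $ (2, 1) $ (2, 1))"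
    by (simp_all add: quat_psd_2_iff qdet_def)
  have "quat_psd (transpose ?B)"
  proof (rule quat_psd_transpose_of_pos_det)
    show "quat_psd ?B"
      using psd \<open>0 < r\<close> by (simp add: quat_psd_add quat_psd_mat)
    show "?B \<in> block_symmetric"
      using sym by (auto simp: block_symmetric_def mat_def)
    show "0 < qRe (?B $ (1, 1) $ (1, 1))" "0 < qRe (?B $ (2, 1) $ (2, 1))"
      using diag \<open>0 < r\<close> by (simp_all add: mat_def)
    \<comment> \<open>The perturbation strictly enlarges the product of the diagonal entries and
      leaves the off-diagonal entry alone.\<close>
    have "qRe (A $ (1, 1) $ (1, 1)) * qRe (A $ (2, 1) $ (2, 1))
        < (qRe (A $ (1, 1) $ (1, 1)) + r) * (qRe (A $ (2, 1) $ (2, 1)) + r)"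
      using diag \<open>0 < r\<close> by (intro mult_strict_mono) auto
    then show "0 < qdet (\<chi> i j. ?B $ (i, 1) $ (j, 1))"
      using diag(3) by (simp add: qdet_def mat_def)
  qed
  then show "quat_psd (transpose A + mat (of_real r))"
    by (simp add: transpose_def mat_def vec_eq_iff plus_vec_def eq_commute[of _ "_ :: 2 \<times> 2"])
qed

theorem corollary8p4:
  fixes A :: "quat^(2 \<times> 2)^(2 \<times> 2)"
  assumes "A \<in> hermitian_tensor_symmetric"
  shows "quat_psd A \<longleftrightarrow> quat_psd (transpose A)"
proof -
  have sym: "A \<in> block_symmetric"
    using assms hermitian_tensor_symmetric_subset by blast
  \<comment> \<open>This lets the one-sided result be applied to \<open>transpose A\<close> as well,
    which gives the converse.\<close>
  then have "transpose A \<in> block_symmetric"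
    by (auto simp: block_symmetric_def transpose_def)
  with sym show ?thesis
    using quat_psd_transpose transpose_transpose by metis
qed

end
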